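(* Let $n\ge 4$ and let $p=a_1e_1^4+a_2e_1^2e_2+a_3e_1e_3+a_4e_4\in\mathbb{R}[x_1,\dots,x_n]$ with $a_1,\dots,a_4\in\mathbb{R}$ (a hook-shaped quartic) and $p(\vec 1)\neq 0$. Let $u\in\mathbb{R}^n$ be a coordinate (standard basis) vector and let $q(t)=p(u+t\vec 1)$. Then $p$ is symmetric hyperbolic if and only if the univariate polynomial $q\left(t-\frac1n\right)$ has only real roots, with at least $3$ of its roots having the same sign.
   Context: $\vec 1=(1,\dots,1)\in\mathbb{R}^n$ and $e_k$ is the $k$-th elementary symmetric polynomial in $x_1,\dots,x_n$. A homogeneous $p$ is hyperbolic with respect to $v\in\mathbb{R}^n$ if $p(v)\ne0$ and for every $x\in\mathbb{R}^n$ the univariate polynomial $p(x+tv)$ in $t$ has only real roots. $p$ is symmetric hyperbolic if it is invariant under all permutations of the variables and hyperbolic with respect to $\vec 1$. Roots are counted with multiplicity, and "at least $3$ roots having the same sign" means that at least $3$ roots are all $\ge0$ or all $\le 0$. *)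

theory Defs
  imports "HOL-Analysis.Analysis" "HOL-Library.Poly_Mapping"
    "HOL-Computational_Algebra.Computational_Algebra"
begin

(* Polynomials over the reals in finitely many variables indexed by 'n: a monomial is its
   exponent vector, and a polynomial is a finitely supported map from monomials to coefficients.
   The ring structure is the convolution product of Poly_Mapping. *)
type_synonym 'n real_mpoly = "('n \<Rightarrow>\<^sub>0 nat) \<Rightarrow>\<^sub>0 real"

definition mconst :: "real \<Rightarrow> 'n real_mpoly" where
  "mconst c = Poly_Mapping.single 0 c"

definition mvar :: "'n \<Rightarrow> 'n real_mpoly" where
  "mvar i = Poly_Mapping.single (Poly_Mapping.single i 1) 1"

(* Substitute f i for the i-th variable in a commutative ring, the coefficients being mapped
   into this ring by c. *)
definition msubst ::
  "(real \<Rightarrow> 'b) \<Rightarrow> ('n::finite \<Rightarrow> 'b) \<Rightarrow> 'n real_mpoly \<Rightarrow> 'b::comm_semiring_1" where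
  "msubst c f p =
     (\<Sum>m\<in>Poly_Mapping.keys p. c (Poly_Mapping.lookup p m) *
        (\<Prod>i\<in>UNIV. f i ^ Poly_Mapping.lookup m i))"

definition meval :: "'n::finite real_mpoly \<Rightarrow> real^'n \<Rightarrow> real" where
  "meval p x = msubst (\<lambda>c. c) (\<lambda>i. x $ i) p"

(* The univariate polynomial p(x + t v) in the indeterminate t. *)
definition mline :: "'n::finite real_mpoly \<Rightarrow> real^'n \<Rightarrow> real^'n \<Rightarrow> real poly" where
  "mline p x v = msubst (\<lambda>c. [:c:]) (\<lambda>i. [:x $ i, v $ i:]) p"

lemma poly_mline: "poly (mline p x v) t = meval p (x + t *\<^sub>R v)"
  by (simp add: mline_def meval_def msubst_def poly_sum poly_prod)

definition esym :: "nat \<Rightarrow> 'n::finite real_mpoly" where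
  "esym k = (\<Sum>S | card S = k. \<Prod>i\<in>S. mvar i)"

definition homogeneous :: "nat \<Rightarrow> 'n::finite real_mpoly \<Rightarrow> bool" where
  "homogeneous d p \<longleftrightarrow>
     (\<forall>m\<in>Poly_Mapping.keys p. (\<Sum>i\<in>UNIV. Poly_Mapping.lookup m i) = d)"

definition only_real_roots :: "real poly \<Rightarrow> bool" where
  "only_real_roots f \<longleftrightarrow>
     (\<forall>z::complex. poly (map_poly complex_of_real f) z = 0 \<longrightarrow> z \<in> \<real>)"

definition hyperbolic_wrt :: "'n::finite real_mpoly \<Rightarrow> real^'n \<Rightarrow> bool" where
  "hyperbolic_wrt p v \<longleftrightarrow>
     (\<exists>d. homogeneous d p) \<and> meval p v \<noteq> 0 \<and> (\<forall>x. only_real_roots (mline p x v))"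

definition symmetric_mpoly :: "'n::finite real_mpoly \<Rightarrow> bool" where
  "symmetric_mpoly p \<longleftrightarrow>
     (\<forall>\<pi>. \<pi> permutes UNIV \<longrightarrow> msubst mconst (\<lambda>i. mvar (\<pi> i)) p = p)"

definition symmetric_hyperbolic :: "'n::finite real_mpoly \<Rightarrow> bool" where
  "symmetric_hyperbolic p \<longleftrightarrow> symmetric_mpoly p \<and> hyperbolic_wrt p (vec 1)"

(* Roots are counted with multiplicity; a zero root counts for both signs. *)
definition has_roots_of_same_sign :: "nat \<Rightarrow> real poly \<Rightarrow> bool" where
  "has_roots_of_same_sign k f \<longleftrightarrow>
     size (filter_mset (\<lambda>r. r \<ge> 0) (proots f)) \<ge> k \<or>
     size (filter_mset (\<lambda>r. r \<le> 0) (proots f)) \<ge> k"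

end

theory Submission
  imports Defs
begin

text \<open>
  Since hyperbolicity with respect to \<open>(1, \<dots>, 1)\<close> is invariant under translation along this vector,
  only points \<open>x\<close> with \<open>e1(x) = 0\<close> matter, and there \<open>p(x + t (1, \<dots>, 1))\<close> is a depressed quartic
  \<open>A t\<^sup>4 + B e2(x) t\<^sup>2 + C e3(x) t + D e4(x)\<close> in \<open>t\<close>. It arises from the \<open>(n - 4)\<close>-th derivative of
  \<open>\<Prod>(t + x\<^sub>i)\<close>, which is real-rooted, by multiplying coefficients; the translate of \<open>u\<close> is the
  case where that derivative is proportional to \<open>(t - 1/n)\<^sup>3 (t + 3/n)\<close>. If the resulting quartic
  for \<open>u\<close> is real-rooted with three roots of the same sign, then the multipliers can be completed
  to a polynomial with four nonnegative roots, and the Schur--Szego composition theorem gives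
  real-rootedness for all \<open>x\<close>. Conversely, \<open>x = (1, 1, -1, -1, 0, \<dots>, 0)\<close> forces \<open>A D \<ge> 0\<close>, so the
  product of the roots for \<open>u\<close> is nonpositive and at least three of them have the same sign.
\<close>

section \<open>Polar derivatives and the upper half-plane\<close>

text \<open>A substitute for real-rootedness that also makes sense for the complex coefficients
  produced by polar derivatives with a non-real pole.\<close>

definition uhp_stable :: "complex poly \<Rightarrow> bool" where
  "uhp_stable A \<longleftrightarrow> (\<forall>z. Im z > 0 \<longrightarrow> poly A z \<noteq> 0)"

lemma poly_prod_linear_eq_0_iff:
  "poly (\<Prod>r\<in>#M. [:- r, 1:]) z = 0 \<longleftrightarrow> (z::complex) \<in># M"
  by (induction M) auto

lemma poly_pderiv_prod_linear:
  fixes z :: complex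
  assumes "z \<notin># M"
  shows "poly (pderiv (\<Prod>r\<in>#M. [:- r, 1:])) z =
         poly (\<Prod>r\<in>#M. [:- r, 1:]) z * (\<Sum>r\<in>#M. 1 / (z - r))"
  using assms
proof (induction M)
  case (add r M)
  then have "z - r \<noteq> 0" by auto
  with add show ?case
    by (simp add: pderiv_mult pderiv_pCons field_simps del: mult_pCons_left)
qed auto

lemma monic_prod_linear: "coeff (\<Prod>r\<in>#M. [:- r, 1::complex:]) (size M) = 1"
proof -
  have nz: "(\<Prod>r\<in>#M. [:- r, 1::complex:]) \<noteq> 0" for M
    by (induction M) (auto simp del: mult_pCons_left)
  have *: "degree (\<Prod>r\<in>#M. [:- r, 1::complex:]) = size M" for M
    using nz by (induction M) (auto simp: degree_mult_eq simp del: mult_pCons_left)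
  show "coeff (\<Prod>r\<in>#M. [:- r, 1::complex:]) (size M) = 1"
  proof (induction M)
    case (add r M)
    have "coeff (\<Prod>r\<in>#M. [:- r, 1::complex:]) (Suc (size M)) = 0"
      by (rule coeff_eq_0) (simp add: *)
    with add show ?case by simp
  qed auto
qed

lemma coeff_prod_linear_subleading:
  "M \<noteq> {#} \<Longrightarrow> coeff (\<Prod>r\<in>#M. [:- r, 1::complex:]) (size M - 1) = - (\<Sum>r\<in>#M. r)"
proof (induction M)
  case (add r M)
  show ?case
  proof (cases "M = {#}")
    case False
    then obtain m where m: "size M = Suc m"
      by (cases "size M") auto
    then show ?thesis
      using add False monic_prod_linear[of M] by (simp add: m)
  qed simp
qed auto

text \<open>Inversion turns the half-plane \<open>Im v \<ge> y\<close> into a disc with centre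
  \<open>- \<i> / (2 * y)\<close>, hence into a convex set. After clearing denominators only the
  squared norms of \<open>2 * y + \<i> * v\<close> and \<open>v\<close> have to be compared.\<close>

lemma inverse_in_disc_iff:
  fixes v :: complex and y :: real
  assumes "v \<noteq> 0" "y > 0"
  shows "norm (1 / v + \<i> / (2 * of_real y)) \<le> 1 / (2 * y) \<longleftrightarrow> y \<le> Im v"
proof -
  have "1 / v + \<i> / (2 * of_real y) = (2 * of_real y + \<i> * v) / (2 * of_real y * v)"
    using assms by (simp add: field_simps)
  then have "norm (1 / v + \<i> / (2 * of_real y)) = norm (2 * of_real y + \<i> * v) / (2 * y * norm v)"
    using assms by (simp add: norm_divide norm_mult)
  also have "\<dots> \<le> 1 / (2 * y) \<longleftrightarrow> norm (2 * of_real y + \<i> * v) \<le> norm v"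
    using assms by (simp add: field_simps)
  also have "\<dots> \<longleftrightarrow> (norm (2 * of_real y + \<i> * v))\<^sup>2 \<le> (norm v)\<^sup>2"
    by (simp add: abs_le_square_iff)
  also have "\<dots> \<longleftrightarrow> y * y \<le> y * Im v"
    unfolding cmod_power2 by (simp add: power2_eq_square algebra_simps)
  also have "\<dots> \<longleftrightarrow> y \<le> Im v"
    using assms by simp
  finally show ?thesis .
qed

text \<open>Convexity of the disc with centre \<open>- c\<close> and radius \<open>\<rho>\<close>,
  in a form suited to sums of reciprocals.\<close>

lemma norm_sum_mset_diff_le:
  fixes c :: complex
  assumes "\<And>r. r \<in># M \<Longrightarrow> norm (f r + c) \<le> \<rho>"
  shows "norm ((\<Sum>r\<in>#M. f r) + of_nat (size M) * c) \<le> of_nat (size M) * \<rho>"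
  using assms
proof (induction M)
  case (add r M)
  have "norm ((\<Sum>r\<in>#add_mset r M. f r) + of_nat (size (add_mset r M)) * c)
        = norm ((f r + c) + ((\<Sum>r\<in>#M. f r) + of_nat (size M) * c))"
    by (simp add: algebra_simps)
  also have "\<dots> \<le> \<rho> + of_nat (size M) * \<rho>"
    by (rule order_trans[OF norm_triangle_ineq add_mono]) (use add in auto)
  finally show ?case by (simp add: algebra_simps)
qed auto

text \<open>
  Laguerre's theorem on polar derivatives for the upper half-plane: the pole is \<open>t / s\<close>, with
  \<open>s = 0\<close> encoding the pole at infinity.
\<close>

lemma polar_derivative_stable:
  fixes A :: "complex poly" and s :: real and t :: complex
  assumes A: "uhp_stable A" and deg: "degree A = Suc n" and s: "s \<ge> 0" and t: "Im t > 0"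
  defines "B \<equiv> smult (of_real s * of_nat (Suc n)) A + [:t, - of_real s:] * pderiv A"
  shows "uhp_stable B" and "degree B = n"
proof -
  define M where "M = proots A"
  define c where "c = lead_coeff A"
  define P where "P = (\<Prod>r\<in>#M. [:- r, 1::complex:])"
  have c: "c \<noteq> 0" and A_eq: "A = smult c P"
    using deg complex_poly_decompose_multiset[of A] by (auto simp: c_def P_def M_def)
  have size: "size M = Suc n"
    using deg by (simp add: M_def size_proots_complex)
  have Im_le: "Im r \<le> 0" if "r \<in># M" for r
    using that A c poly_prod_linear_eq_0_iff[of M r]
    by (force simp: uhp_stable_def A_eq P_def not_le)
  show "uhp_stable B"
    unfolding uhp_stable_def
  proof (intro allI impI notI)
    fix z :: complex
    assume z: "Im z > 0" and "poly B z = 0"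
    have zM: "z \<notin># M"
      using Im_le z by force
    define W where "W = (\<Sum>r\<in>#M. 1 / (z - r))"
    have Pz: "poly P z \<noteq> 0"
      using zM poly_prod_linear_eq_0_iff[of M z] by (simp add: P_def)
    have "poly B z = c * poly P z * (of_real s * of_nat (Suc n) + (t - of_real s * z) * W)"
      using poly_pderiv_prod_linear[OF zM]
      by (simp add: B_def A_eq P_def[symmetric] W_def pderiv_smult algebra_simps)
    with \<open>poly B z = 0\<close> c Pz
    have eq: "of_real s * of_nat (Suc n) + (t - of_real s * z) * W = 0"
      by simp
    \<comment> \<open>No root lies above the real axis, so \<open>Im (z - r) \<ge> Im z\<close>, and
      every summand of \<open>W\<close> lies in the disc with centre \<open>- d\<close>.\<close>
    define d where "d = \<i> / (2 * of_real (Im z))"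
    have disc: "norm (W + of_nat (size M) * d) \<le> of_nat (size M) * (1 / (2 * Im z))"
      unfolding W_def d_def
    proof (rule norm_sum_mset_diff_le)
      fix r assume r: "r \<in># M"
      then have "z - r \<noteq> 0" using zM by auto
      then show "norm (1 / (z - r) + \<i> / (2 * of_real (Im z))) \<le> 1 / (2 * Im z)"
        using inverse_in_disc_iff[of "z - r" "Im z"] z Im_le[OF r] by simp
    qed
    show False
    proof (cases "s = 0")
      case True
      have "M \<noteq> {#}" using size by auto
      \<comment> \<open>With the pole at infinity, \<open>eq\<close> reads \<open>t * W = 0\<close>.
        This fails because \<open>t\<close> is nonzero and \<open>W\<close> has negative imaginary
        part.\<close>
      have "(\<Sum>r\<in>#M. Im (1 / (z - r))) < 0"
        using \<open>M \<noteq> {#}\<close> Im_le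
      proof (induction M)
        case (add r M)
        have "Im (z - r) > 0"
          using z add.prems(2)[of r] by simp
        moreover have "Im (1 / v) < 0" if "Im v > 0" for v :: complex
        proof -
          have "Im (1 / v) = - (Im v / (norm v)\<^sup>2)" "norm v > 0"
            using that by (auto simp: Im_divide cmod_power2)
          then show ?thesis using that by simp
        qed
        ultimately have "Im (1 / (z - r)) < 0" by blast
        with add show ?case by (cases "M = {#}") auto
      qed auto
      also have "(\<Sum>r\<in>#M. Im (1 / (z - r))) = Im W"
        unfolding W_def by (induction M) auto
      finally show False
        using eq True t by auto
    next
      case False
      \<comment> \<open>By \<open>eq\<close>, the mean of the numbers \<open>1 / (z - r)\<close>
        equals \<open>1 / v\<close>, so it lies in the same disc and \<open>Im z \<le> Im v\<close>.
        But the pole \<open>t / s\<close> has positive imaginary part.\<close>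
      define v where "v = z - t / of_real s"
      have v: "of_real s * v = of_real s * z - t"
        using False by (simp add: v_def field_simps)
      have "of_real s * of_nat (Suc n) = of_real s * v * W"
      proof -
        have "t - of_real s * z = - (of_real s * v)"
          by (simp add: v)
        then show ?thesis
          using eq by simp
      qed
      then have vW: "of_nat (Suc n) = v * W"
        using False by simp
      then have v0: "v \<noteq> 0" by (metis mult_zero_left of_nat_neq_0)
      have "W = of_nat (Suc n) * (1 / v)"
        using vW v0 by (simp add: field_simps)
      then have "norm (of_nat (Suc n) * (1 / v + d)) \<le> of_nat (Suc n) * (1 / (2 * Im z))"
        using disc by (simp only: size distrib_left)
      then have "norm (1 / v + d) \<le> 1 / (2 * Im z)"
        unfolding norm_mult norm_of_nat by (subst (asm) mult_le_cancel_left_pos) auto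
      then have "Im z \<le> Im v"
        using inverse_in_disc_iff[OF v0 z] by (simp add: d_def)
      moreover have "Im v < Im z"
        using t s False by (simp add: v_def)
      ultimately show False by simp
    qed
  qed
  have coeff_B: "coeff B k = of_real s * of_nat (Suc n) * coeff A k
       + t * of_nat (Suc k) * coeff A (Suc k) - of_real s * of_nat k * coeff A k" for k
    by (cases k) (simp_all add: B_def coeff_pderiv algebra_simps)
  have "coeff B k = 0" if "k > n" for k
  proof (cases "k = Suc n")
    case True
    then show ?thesis
      using deg by (simp add: coeff_B coeff_eq_0 algebra_simps)
  next
    case False
    then show ?thesis
      using that deg by (simp add: coeff_B coeff_eq_0)
  qed
  then have "degree B \<le> n"
    using degree_le by blast
  \<comment> \<open>The degree drops by exactly one: up to the factor \<open>c\<close>, this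
    coefficient has positive imaginary part, since all roots lie in the closed lower
    half-plane.\<close>
  moreover have "coeff B n \<noteq> 0"
  proof -
    have "M \<noteq> {#}"
      using size by auto
    then have "coeff P (Suc n) = 1" "coeff P n = - (\<Sum>r\<in>#M. r)"
      using monic_prod_linear[of M] coeff_prod_linear_subleading[of M] size
      by (auto simp: P_def)
    then have coeff_B_n: "coeff B n = c * (of_nat (Suc n) * t - of_real s * (\<Sum>r\<in>#M. r))"
      unfolding coeff_B A_eq by (simp add: algebra_simps)
    have "Im (\<Sum>r\<in>#M. r) \<le> 0"
      using Im_le by (induction M) (auto intro: add_nonpos_nonpos)
    then have "s * Im (\<Sum>r\<in>#M. r) \<le> 0"
      using s by (rule mult_nonneg_nonpos[rotated])
    moreover have "real (Suc n) * Im t > 0"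
      using t by (intro mult_pos_pos) auto
    moreover have "Im (of_nat (Suc n) * t - of_real s * (\<Sum>r\<in>#M. r)) =
        real (Suc n) * Im t - s * Im (\<Sum>r\<in>#M. r)"
      by simp
    ultimately have "Im (of_nat (Suc n) * t - of_real s * (\<Sum>r\<in>#M. r)) > 0"
      by linarith
    then have "of_nat (Suc n) * t - of_real s * (\<Sum>r\<in>#M. r) \<noteq> 0"
      by (metis less_irrefl zero_complex.sel(2))
    then show ?thesis
      unfolding coeff_B_n using c by (rule no_zero_divisors[rotated])
  qed
  ultimately show "degree B = n"
    using le_degree by (metis antisym)
qed

section \<open>Composition of depressed quartics\<close>

text \<open>The nonreal roots of a real polynomial come in conjugate pairs, so it suffices to
  exclude one half-plane.\<close>

lemma only_real_roots_iff_uhp_stable: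
  "only_real_roots f \<longleftrightarrow> uhp_stable (map_poly complex_of_real f)"
proof
  assume "only_real_roots f"
  then show "uhp_stable (map_poly complex_of_real f)"
    by (auto simp: only_real_roots_def uhp_stable_def complex_is_Real_iff)
next
  assume stable: "uhp_stable (map_poly complex_of_real f)"
  show "only_real_roots f"
    unfolding only_real_roots_def
  proof (intro allI impI)
    fix z assume z: "poly (map_poly complex_of_real f) z = 0"
    then have "poly (map_poly complex_of_real f) (cnj z) = 0"
      by (subst real_poly_cnj_root_iff) (simp_all add: coeff_map_poly)
    then have "\<not> Im (cnj z) > 0" "\<not> Im z > 0"
      using stable z unfolding uhp_stable_def by blast+
    then show "z \<in> \<real>"
      by (simp add: complex_is_Real_iff)
  qed
qed

text \<open>The polar derivative with the pole at infinity is the ordinary derivative up to the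
  factor \<open>t\<close>, taken here to be \<open>\<i>\<close>.\<close>

lemma only_real_roots_pderiv:
  assumes "only_real_roots f" "degree f = Suc n"
  shows "only_real_roots (pderiv f)" "degree (pderiv f) = n"
proof -
  let ?F = "map_poly complex_of_real f"
  have stable: "uhp_stable ?F" and deg: "degree ?F = Suc n"
    using assms by (simp_all add: only_real_roots_iff_uhp_stable degree_map_poly)
  have "uhp_stable ([:\<i>:] * pderiv ?F)"
    using polar_derivative_stable(1)[OF stable deg, of 0 \<i>] by simp
  moreover have "map_poly complex_of_real (pderiv f) = pderiv ?F"
    by (rule poly_eqI) (simp add: coeff_map_poly coeff_pderiv)
  ultimately show "only_real_roots (pderiv f)"
    by (simp add: only_real_roots_iff_uhp_stable uhp_stable_def)
  show "degree (pderiv f) = n"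
    using assms by (simp add: degree_pderiv)
qed

lemma only_real_roots_higher_pderiv:
  assumes "only_real_roots f" "degree f = m + n"
  shows "only_real_roots ((pderiv ^^ m) f)"
  using assms
proof (induction m arbitrary: f)
  case (Suc m)
  then have "only_real_roots ((pderiv ^^ m) (pderiv f))"
    using only_real_roots_pderiv[of f "m + n"] by simp
  then show ?case by (simp only: funpow_Suc_right o_apply)
qed simp

text \<open>
  Up to signs and binomial factors, the multipliers are the coefficients of the quartic with the
  nonnegative roots \<open>s1\<close>, \<open>s2\<close>, \<open>s3\<close>, \<open>s4\<close>, so this is a Schur--Szego composition. Four polar
  derivatives with the poles \<open>t / si\<close> reduce the given quartic to a constant, which is 24 times
  the value of the composition at \<open>t\<close>.
\<close>

lemma quartic_composition_stable:
  fixes s1 s2 s3 s4 :: real and b c d :: complex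
  assumes nonneg: "s1 \<ge> 0" "s2 \<ge> 0" "s3 \<ge> 0" "s4 \<ge> 0"
    and stable: "uhp_stable [:d, 4 * c, 6 * b, 0, 1:]"
  defines "e2 \<equiv> s1 * s2 + s1 * s3 + s1 * s4 + s2 * s3 + s2 * s4 + s3 * s4"
    and "e3 \<equiv> s1 * s2 * s3 + s1 * s2 * s4 + s1 * s3 * s4 + s2 * s3 * s4"
    and "e4 \<equiv> s1 * s2 * s3 * s4"
  shows "uhp_stable [:of_real e4 * d, of_real e3 * c, of_real e2 * b, 0, 1:]"
  unfolding uhp_stable_def
proof (intro allI impI)
  fix t :: complex
  assume t: "Im t > 0"
  define polar :: "nat \<Rightarrow> real \<Rightarrow> complex poly \<Rightarrow> complex poly" where
    "polar n s A = smult (of_real s * of_nat n) A + [:t, - of_real s:] * pderiv A" for n s A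
  have step: "uhp_stable (polar (Suc n) s A) \<and> degree (polar (Suc n) s A) = n"
    if "uhp_stable A" "degree A = Suc n" "s \<ge> 0" for n s A
    using polar_derivative_stable[OF that t] by (simp add: polar_def)
  define A0 where "A0 = [:d, 4 * c, 6 * b, 0, 1:]"
  define A1 where "A1 = polar (Suc 3) s1 A0"
  define A2 where "A2 = polar (Suc 2) s2 A1"
  define A3 where "A3 = polar (Suc 1) s3 A2"
  define A4 where "A4 = polar (Suc 0) s4 A3"
  have "uhp_stable A1 \<and> degree A1 = 3"
    unfolding A1_def using stable nonneg by (intro step) (simp_all add: A0_def)
  then have "uhp_stable A2 \<and> degree A2 = 2"
    unfolding A2_def using nonneg by (intro step) simp_all
  then have "uhp_stable A3 \<and> degree A3 = 1"
    unfolding A3_def using nonneg by (intro step) simp_all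
  then have A4: "uhp_stable A4 \<and> degree A4 = 0"
    unfolding A4_def using nonneg by (intro step) simp_all
  have p4: "polar (Suc 3) s [:a0, a1, a2, a3, a4:] =
      [:4 * s * a0 + t * a1, 3 * s * a1 + 2 * t * a2, 2 * s * a2 + 3 * t * a3, s * a3 + 4 * t * a4:]"
    for s a0 a1 a2 a3 a4
    by (simp add: polar_def pderiv_pCons algebra_simps)
  have p3: "polar (Suc 2) s [:a0, a1, a2, a3:] =
      [:3 * s * a0 + t * a1, 2 * s * a1 + 2 * t * a2, s * a2 + 3 * t * a3:]"
    for s a0 a1 a2 a3
    by (simp add: polar_def pderiv_pCons algebra_simps)
  have p2: "polar (Suc 1) s [:a0, a1, a2:] = [:2 * s * a0 + t * a1, s * a1 + 2 * t * a2:]"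
    for s a0 a1 a2
    by (simp add: polar_def pderiv_pCons algebra_simps)
  have p1: "polar (Suc 0) s [:a0, a1:] = [:s * a0 + t * a1:]" for s a0 a1
    by (simp add: polar_def pderiv_pCons algebra_simps)
  have "A4 = [:24 * poly [:of_real e4 * d, of_real e3 * c, of_real e2 * b, 0, 1:] t:]"
    unfolding A4_def A3_def A2_def A1_def A0_def p4 p3 p2 p1 e2_def e3_def e4_def
    by (simp add: algebra_simps)
  moreover have "poly A4 t \<noteq> 0"
    using A4 t by (simp add: uhp_stable_def)
  ultimately have "24 * poly [:of_real e4 * d, of_real e3 * c, of_real e2 * b, 0, 1:] t \<noteq> 0"
    by (simp only: poly_pCons poly_0 mult_zero_right add_0_right not_False_eq_True)
  then show "poly [:of_real e4 * d, of_real e3 * c, of_real e2 * b, 0, 1:] t \<noteq> 0"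
    by (metis mult_zero_right)
qed

text \<open>
  If \<open>f\<close> is the quartic with the roots \<open>x\<close>, \<open>y\<close>, \<open>z\<close>, \<open>- (x + y + z)\<close>, then a quartic \<open>h\<close> with
  \<open>f = t h' - 3 h\<close>, that is \<open>(h / t\<^sup>3)' = f / t\<^sup>4\<close>, is determined up to its cubic coefficient. Choosing
  the latter such that \<open>h\<close> vanishes at the middle root \<open>y\<close> makes all roots of \<open>h\<close> nonnegative,
  because \<open>h / t\<^sup>3\<close> has a local maximum there.
\<close>

lemma nonneg_roots_exist:
  fixes x y z :: real
  assumes "0 \<le> x" "x \<le> y" "y \<le> z"
  obtains s1 s2 s3 s4 where "s1 \<ge> 0" "s2 \<ge> 0" "s3 \<ge> 0" "s4 \<ge> 0"
    "s1 * s2 + s1 * s3 + s1 * s4 + s2 * s3 + s2 * s4 + s3 * s4 =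
       x\<^sup>2 + y\<^sup>2 + z\<^sup>2 + x * y + y * z + z * x"
    "2 * (s1 * s2 * s3 + s1 * s2 * s4 + s1 * s3 * s4 + s2 * s3 * s4) = (x + y) * (y + z) * (z + x)"
    "3 * (s1 * s2 * s3 * s4) = x * y * z * (x + y + z)"
proof (cases "y = 0")
  case True
  then have "x = 0" using assms by simp
  with True show thesis
    using assms by (intro that[of 0 0 z z]) (simp_all add: power2_eq_square)
next
  case False
  then have y: "y > 0" using assms by simp
  \<comment> \<open>Since \<open>f\<close> and \<open>h\<close> vanish at \<open>y\<close>, so does
    \<open>h'\<close>, and \<open>h = (t - y)^2 (t^2 - m t + l)\<close>. Comparing constant and
    quadratic coefficients gives \<open>l\<close> and \<open>m\<close>.\<close>
  define l where "l = x * z * (x + y + z) / (3 * y)"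
  define m where "m = (x\<^sup>2 + z\<^sup>2 + x * y + y * z + z * x - l) / (2 * y)"
  have l: "3 * y * l = x * z * (x + y + z)"
    using y by (simp add: l_def)
  have m: "2 * y * m = x\<^sup>2 + z\<^sup>2 + x * y + y * z + z * x - l"
    using y by (simp add: m_def)
  have l0: "l \<ge> 0"
    using assms y by (simp add: l_def)
  have "x * z * (x + y + z) \<le> y * z * (x + y + z)"
    using assms by (intro mult_right_mono) auto
  then have "y * (3 * l) \<le> y * (z * (x + y + z))"
    using l by (simp add: mult_ac)
  then have "3 * l \<le> z * (x + y + z)"
    using y by simp
  moreover have "x\<^sup>2 + x * y \<ge> 0"
    using assms by simp
  ultimately have "l \<le> x\<^sup>2 + z\<^sup>2 + x * y + y * z + z * x"
    using l0 by (simp add: power2_eq_square algebra_simps)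
  then have m0: "m \<ge> 0"
    using y by (simp add: m_def)
  \<comment> \<open>The quadratic cofactor is nonpositive at \<open>y\<close>, as \<open>y\<close>
    lies between \<open>x\<close> and \<open>z\<close>; hence its discriminant is
    nonnegative.\<close>
  have "2 * y * (y\<^sup>2 - m * y + l) = (y - x) * (y - z) * (2 * y + x + z)"
  proof -
    have "2 * y * (y\<^sup>2 - m * y + l) = 2 * y * y\<^sup>2 - y * (2 * y * m) + 2 * y * l"
      by (simp add: algebra_simps)
    also have "\<dots> = 2 * y * y\<^sup>2 - y * (x\<^sup>2 + z\<^sup>2 + x * y + y * z + z * x) + 3 * y * l"
      unfolding m by (simp add: algebra_simps)
    also have "\<dots> = (y - x) * (y - z) * (2 * y + x + z)"
      unfolding l by (simp add: algebra_simps power2_eq_square)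
    finally show ?thesis .
  qed
  also have "\<dots> \<le> 0"
    using assms by (intro mult_nonpos_nonneg mult_nonneg_nonpos) auto
  finally have "y\<^sup>2 - m * y + l \<le> 0"
    using y by (simp add: mult_le_0_iff)
  then have "(2 * y - m)\<^sup>2 + 4 * (- (y\<^sup>2 - m * y + l)) \<ge> 0"
    by (intro add_nonneg_nonneg) auto
  also have "(2 * y - m)\<^sup>2 + 4 * (- (y\<^sup>2 - m * y + l)) = m\<^sup>2 - 4 * l"
    by (simp add: power2_eq_square algebra_simps)
  finally have disc: "m\<^sup>2 - 4 * l \<ge> 0" .
  define w where "w = sqrt (m\<^sup>2 - 4 * l)"
  have w2: "w\<^sup>2 = m\<^sup>2 - 4 * l"
    using disc by (simp add: w_def)
  have w0: "w \<ge> 0" using disc by (simp add: w_def)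
  have "w\<^sup>2 \<le> m\<^sup>2"
    unfolding w2 using l0 by simp
  then have "w \<le> m"
    using m0 by (rule power2_le_imp_le)
  define s3 where "s3 = (m + w) / 2"
  define s4 where "s4 = (m - w) / 2"
  have sum: "s3 + s4 = m"
    unfolding s3_def s4_def by (simp add: field_simps)
  have prod: "s3 * s4 = l"
    using w2 by (simp add: s3_def s4_def field_simps power2_eq_square)
  show thesis
  proof (rule that[of y y s3 s4])
    show "s3 \<ge> 0" "s4 \<ge> 0"
      using m0 w0 \<open>w \<le> m\<close> by (simp_all add: s3_def s4_def)
    have "y * y + y * s3 + y * s4 + y * s3 + y * s4 + s3 * s4 = y * y + 2 * y * (s3 + s4) + s3 * s4"
      by (simp add: algebra_simps)
    also have "\<dots> = y * y + 2 * y * m + l"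
      unfolding sum prod ..
    finally show "y * y + y * s3 + y * s4 + y * s3 + y * s4 + s3 * s4
        = x\<^sup>2 + y\<^sup>2 + z\<^sup>2 + x * y + y * z + z * x"
      by (simp add: m power2_eq_square)
    have "2 * (y * y * s3 + y * y * s4 + y * s3 * s4 + y * s3 * s4)
        = y * (2 * y * (s3 + s4)) + 4 * y * (s3 * s4)"
      by (simp add: algebra_simps)
    also have "\<dots> = y * (x\<^sup>2 + z\<^sup>2 + x * y + y * z + z * x) + 3 * y * l"
      unfolding sum prod m by (simp add: algebra_simps)
    also have "\<dots> = (x + y) * (y + z) * (z + x)"
      unfolding l by (simp add: algebra_simps power2_eq_square)
    finally show "2 * (y * y * s3 + y * y * s4 + y * s3 * s4 + y * s3 * s4) = (x + y) * (y + z) * (z + x)" .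
    have "3 * (y * y * s3 * s4) = y * (3 * y * (s3 * s4))"
      by (simp add: algebra_simps)
    then show "3 * (y * y * s3 * s4) = x * y * z * (x + y + z)"
      unfolding prod l by (simp add: algebra_simps)
  qed (use y in auto)
qed

section \<open>Real-rooted polynomials\<close>

lemma map_poly_of_real_mult:
  "map_poly complex_of_real (f * g) = map_poly complex_of_real f * map_poly complex_of_real g"
  by (rule poly_eqI) (simp add: coeff_map_poly coeff_mult)

lemma map_poly_of_real_add:
  "map_poly complex_of_real (f + g) = map_poly complex_of_real f + map_poly complex_of_real g"
  by (rule poly_eqI) (simp add: coeff_map_poly)

lemma map_poly_of_real_pcompose:
  "map_poly complex_of_real (f \<circ>\<^sub>p g) = map_poly complex_of_real f \<circ>\<^sub>p map_poly complex_of_real g"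
  by (induction f)
     (simp_all add: pcompose_pCons map_poly_of_real_mult map_poly_of_real_add map_poly_pCons)

lemma only_real_roots_mult_iff:
  "only_real_roots (f * g) \<longleftrightarrow> only_real_roots f \<and> only_real_roots g"
  by (auto simp: only_real_roots_def map_poly_of_real_mult)

lemma only_real_roots_smult_iff:
  "c \<noteq> 0 \<Longrightarrow> only_real_roots (smult c f) \<longleftrightarrow> only_real_roots f"
  by (simp add: only_real_roots_def map_poly_smult)

lemma only_real_roots_linear: "only_real_roots [:a, 1:]"
  by (auto simp: only_real_roots_def map_poly_pCons complex_is_Real_iff add_eq_0_iff)

lemma only_real_roots_affine:
  assumes "only_real_roots f" "b \<noteq> 0"
  shows "only_real_roots (f \<circ>\<^sub>p [:a, b:])"
  unfolding only_real_roots_def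
proof (intro allI impI)
  fix z assume "poly (map_poly complex_of_real (f \<circ>\<^sub>p [:a, b:])) z = 0"
  then have "poly (map_poly complex_of_real f) (of_real a + z * of_real b) = 0"
    by (simp add: map_poly_of_real_pcompose poly_pcompose map_poly_pCons)
  then have "of_real a + z * of_real b \<in> \<real>"
    using assms(1) by (simp add: only_real_roots_def)
  then show "z \<in> \<real>"
    using assms(2) by (simp add: complex_is_Real_iff)
qed

text \<open>The fundamental theorem of algebra supplies a root, which is real by assumption; its
  linear factor is split off and the quotient remains real-rooted.\<close>

lemma only_real_roots_decompose:
  assumes "only_real_roots f" "f \<noteq> 0"
  shows "f = smult (lead_coeff f) (\<Prod>r\<in>#proots f. [:- r, 1:])" and "size (proots f) = degree f"
proof -
  have "\<exists>c M. f = smult c (\<Prod>r\<in>#M. [:- r, 1:]) \<and> size M = degree f"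
    using assms
  proof (induction "degree f" arbitrary: f)
    case 0
    then obtain c where "f = [:c:]"
      by (metis degree_0_id)
    then show ?case
      by (intro exI[of _ c] exI[of _ "{#}"]) simp
  next
    case (Suc n)
    let ?F = "map_poly complex_of_real f"
    have "degree ?F = Suc n"
      using Suc by (simp add: degree_map_poly)
    then obtain z where z: "poly ?F z = 0"
      using fundamental_theorem_of_algebra[of ?F] constant_degree[of ?F] by auto
    then obtain r where "z = of_real r"
      using Suc.prems by (auto simp: only_real_roots_def elim: Reals_cases)
    moreover have "poly (map_poly complex_of_real f) (of_real r) = of_real (poly f r)"
      by (induction f) (simp_all add: map_poly_pCons)
    ultimately have "poly f r = 0"
      using z by simp
    then obtain g where g: "f = [:- r, 1:] * g"
      by (auto simp: poly_eq_0_iff_dvd elim: dvdE)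
    have "g \<noteq> 0" using g Suc.prems by auto
    then have deg: "degree f = Suc (degree g)"
      unfolding g by (subst degree_mult_eq) auto
    have "only_real_roots g"
      using Suc.prems g only_real_roots_mult_iff by metis
    then obtain c M where M: "g = smult c (\<Prod>r\<in>#M. [:- r, 1:])" "size M = degree g"
      using Suc deg \<open>g \<noteq> 0\<close> by (metis Suc_inject)
    have "f = smult c (\<Prod>r\<in>#add_mset r M. [:- r, 1:])"
      unfolding g M(1) by (simp del: mult_pCons_left)
    moreover have "size (add_mset r M) = degree f"
      using deg M by simp
    ultimately show ?case by blast
  qed
  then obtain c M where f: "f = smult c (\<Prod>r\<in>#M. [:- r, 1:])" and size: "size M = degree f"
    by blast
  have "proots f = M"
    using assms(2) unfolding f by (induction M) (auto simp: proots_mult simp del: mult_pCons_left)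
  moreover have "lead_coeff (\<Prod>r\<in>#M. [:- r, 1:]) = 1"
    by (induction M) (auto simp: lead_coeff_mult simp del: mult_pCons_left)
  ultimately show "f = smult (lead_coeff f) (\<Prod>r\<in>#proots f. [:- r, 1:])" "size (proots f) = degree f"
    using f size by (auto simp del: mult_pCons_left)
qed

text \<open>Vieta's formulas, with the fourth root eliminated through the vanishing cubic
  coefficient. The resulting forms match those in \<open>nonneg_roots_exist\<close>.\<close>

lemma depressed_quartic_coeffs:
  fixes a b c :: real
  assumes f: "[:c, b, a, 0, A:] = smult A (\<Prod>r\<in>#{#x, y, z, w#}. [:- r, 1:])" and A: "A \<noteq> 0"
  shows "w = - (x + y + z)"
    and "a = - A * (x\<^sup>2 + y\<^sup>2 + z\<^sup>2 + x * y + y * z + z * x)"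
    and "b = A * ((x + y) * (y + z) * (z + x))"
    and "c = - A * (x * y * z * (x + y + z))"
proof -
  have eqs: "A * (w + x + y + z) = 0"
    "a = A * (x * y + x * z + x * w + y * z + y * w + z * w)"
    "b = - A * (x * y * z + x * y * w + x * z * w + y * z * w)"
    "c = A * (x * y * z * w)"
    using f by (simp_all add: algebra_simps)
  show w: "w = - (x + y + z)"
    using eqs(1) A by simp
  show "a = - A * (x\<^sup>2 + y\<^sup>2 + z\<^sup>2 + x * y + y * z + z * x)"
    "b = A * ((x + y) * (y + z) * (z + x))" "c = - A * (x * y * z * (x + y + z))"
    unfolding eqs w by (simp_all add: algebra_simps power2_eq_square)
qed

lemma size_4_mset:
  assumes "size M = 4"
  obtains x y z w where "M = {#x, y, z, w#}"
proof -
  obtain xs where "mset xs = M" using ex_mset by blast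
  with assms have "length xs = 4" by (metis size_mset)
  then obtain x y z w where "xs = [x, y, z, w]"
    by (auto simp: numeral_eq_Suc length_Suc_conv)
  with \<open>mset xs = M\<close> show thesis
    by (intro that[of x y z w]) auto
qed

text \<open>The product of the four roots is nonpositive. Either some root is 0 and counts for both
  signs, or an odd number of roots is negative.\<close>

lemma same_sign_of_quartic:
  assumes "only_real_roots [:c, b, a, 0, A:]" "A \<noteq> 0" "c * A \<le> 0"
  shows "has_roots_of_same_sign 3 [:c, b, a, 0, A:]"
proof -
  define f where "f = [:c, b, a, 0, A:]"
  have f: "f \<noteq> 0" "degree f = 4" "lead_coeff f = A" "only_real_roots f"
    using assms by (simp_all add: f_def)
  note dec = only_real_roots_decompose[OF f(4,1)]
  obtain x y z w where M: "proots f = {#x, y, z, w#}"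
    using dec(2) f(2) size_4_mset by metis
  have "c = coeff f 0" by (simp add: f_def)
  also have "\<dots> = A * (x * y * z * w)"
    using arg_cong[OF dec(1), of "\<lambda>g. coeff g 0"] unfolding f(3) M by (simp add: algebra_simps)
  finally have "c * A = A\<^sup>2 * (x * y * z * w)"
    by (simp add: power2_eq_square)
  then have "x * y * z * w \<le> 0"
    using assms by (simp add: mult_le_0_iff)
  then show ?thesis
    unfolding f_def[symmetric] has_roots_of_same_sign_def M
    by (auto simp: mult_le_0_iff zero_le_mult_iff)
qed

lemma mset_three_sorted:
  fixes M :: "'a::linorder multiset"
  assumes "size (filter_mset P M) \<ge> 3" "size M = 4"
  obtains x y z w where "M = {#x, y, z, w#}" "P x" "P y" "P z" "x \<le> y" "y \<le> z"
proof -
  define N where "N = filter_mset P M"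
  obtain x y z ws where xs: "sorted_list_of_multiset N = x # y # z # ws"
  proof -
    have "length (sorted_list_of_multiset N) \<ge> 3"
      using assms by (simp add: N_def flip: size_mset)
    then show thesis
      using that by (auto simp: numeral_eq_Suc Suc_le_length_iff)
  qed
  have "N = mset (x # y # z # ws)"
    by (metis xs mset_sorted_list_of_multiset)
  then have N: "N = {#x, y, z#} + mset ws"
    by simp
  have "M = N + filter_mset (\<lambda>x. \<not> P x) M"
    by (simp add: N_def)
  then obtain R where M: "M = {#x, y, z#} + R"
    unfolding N by (metis add.assoc)
  with assms(2) have "size R = 1" by simp
  then obtain w where "R = {#w#}"
    by (metis size_1_singleton_mset)
  moreover have "x \<le> y" "y \<le> z"
    using sorted_sorted_list_of_multiset[of N] by (auto simp: xs)
  moreover have "\<forall>v\<in>#N. P v"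
    by (simp add: N_def)
  then have "P x" "P y" "P z"
    by (simp_all add: N)
  ultimately show thesis
    using M by (intro that[of x y z w]) auto
qed

text \<open>Since \<open>(t - 1)^3 (t + 3) = t^4 - 6 t^2 + 8 t - 3\<close>, the first quartic is the
  image of this polynomial under the coefficient multipliers \<open>A\<close>, \<open>B\<close>,
  \<open>C\<close>, \<open>D\<close>. If that image is real-rooted with the right signs, the same
  multipliers preserve the real-rootedness of every monic depressed quartic.\<close>

lemma quartic_composition:
  assumes A: "A \<noteq> 0"
    and f: "only_real_roots [:- 3 * D, 8 * C, - 6 * B, 0, A:]"
    and sign: "has_roots_of_same_sign 3 [:- 3 * D, 8 * C, - 6 * B, 0, A:]"
    and g: "only_real_roots [:d, 4 * c, 6 * b, 0, 1:]"
  shows "only_real_roots [:D * d, 4 * C * c, 6 * B * b, 0, A:]"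
proof -
  have nonneg_case: "only_real_roots [:D * d, 4 * C * c, 6 * B * b, 0, A:]"
    if xyz: "0 \<le> x" "x \<le> y" "y \<le> z"
      and B: "6 * B = A * (x\<^sup>2 + y\<^sup>2 + z\<^sup>2 + x * y + y * z + z * x)"
      and C: "8 * C = A * ((x + y) * (y + z) * (z + x))"
      and D: "3 * D = A * (x * y * z * (x + y + z))"
      and g: "only_real_roots [:d, 4 * c, 6 * b, 0, 1:]"
    for x y z B C D d c b
  proof -
    obtain s1 s2 s3 s4 where s: "s1 \<ge> 0" "s2 \<ge> 0" "s3 \<ge> 0" "s4 \<ge> 0"
      and e2: "s1 * s2 + s1 * s3 + s1 * s4 + s2 * s3 + s2 * s4 + s3 * s4 =
         x\<^sup>2 + y\<^sup>2 + z\<^sup>2 + x * y + y * z + z * x"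
      and e3: "2 * (s1 * s2 * s3 + s1 * s2 * s4 + s1 * s3 * s4 + s2 * s3 * s4) =
         (x + y) * (y + z) * (z + x)"
      and e4: "3 * (s1 * s2 * s3 * s4) = x * y * z * (x + y + z)"
      using nonneg_roots_exist[OF xyz] by metis
    define E2 E3 E4 where "E2 = s1 * s2 + s1 * s3 + s1 * s4 + s2 * s3 + s2 * s4 + s3 * s4"
      and "E3 = s1 * s2 * s3 + s1 * s2 * s4 + s1 * s3 * s4 + s2 * s3 * s4"
      and "E4 = s1 * s2 * s3 * s4"
    have stable: "uhp_stable [:of_real d, 4 * of_real c, 6 * of_real b, 0, 1:]"
      using g by (simp add: only_real_roots_iff_uhp_stable map_poly_pCons)
    have "only_real_roots [:E4 * d, E3 * c, E2 * b, 0, 1:]"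
      using quartic_composition_stable[OF s stable]
      by (simp add: only_real_roots_iff_uhp_stable map_poly_pCons E2_def E3_def E4_def)
    then have real: "only_real_roots (smult A [:E4 * d, E3 * c, E2 * b, 0, 1:])"
      using only_real_roots_smult_iff[OF A] by blast
    have "A * E2 = 6 * B"
      using B e2 by (simp add: E2_def)
    moreover have "A * (2 * E3) = 8 * C"
      unfolding C e3[folded E3_def] ..
    then have "A * E3 = 4 * C"
      by simp
    moreover have "A * (3 * E4) = 3 * D"
      unfolding D e4[folded E4_def] ..
    then have "A * E4 = D"
      by simp
    ultimately have smult_eq: "smult A [:E4 * d, E3 * c, E2 * b, 0, 1:] = [:D * d, 4 * C * c, 6 * B * b, 0, A:]"
      by (simp add: mult.assoc[symmetric])
    show ?thesis
      using real unfolding smult_eq .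
  qed
  define q where "q = [:- 3 * D, 8 * C, - 6 * B, 0, A:]"
  have q: "q \<noteq> 0" "degree q = 4" "lead_coeff q = A" "only_real_roots q"
    using A f by (simp_all add: q_def)
  note dec = only_real_roots_decompose[OF q(4,1)]
  have coeffs: "6 * B = A * (x\<^sup>2 + y\<^sup>2 + z\<^sup>2 + x * y + y * z + z * x)"
    "8 * C = A * ((x + y) * (y + z) * (z + x))" "3 * D = A * (x * y * z * (x + y + z))"
    if M: "proots q = {#x, y, z, w#}" for x y z w
  proof -
    have "[:- 3 * D, 8 * C, - 6 * B, 0, A:] = smult A (\<Prod>r\<in>#{#x, y, z, w#}. [:- r, 1:])"
      using dec(1) unfolding M q(3) unfolding q_def .
    from depressed_quartic_coeffs(2-4)[OF this A]
    show "6 * B = A * (x\<^sup>2 + y\<^sup>2 + z\<^sup>2 + x * y + y * z + z * x)"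
      "8 * C = A * ((x + y) * (y + z) * (z + x))" "3 * D = A * (x * y * z * (x + y + z))"
      by simp_all
  qed
  have size4: "size (proots q) = 4"
    using dec(2) q(2) by simp
  from sign consider "size (filter_mset (\<lambda>r. r \<ge> 0) (proots q)) \<ge> 3"
    | "size (filter_mset (\<lambda>r. r \<le> 0) (proots q)) \<ge> 3"
    unfolding has_roots_of_same_sign_def q_def by blast
  then show ?thesis
  proof cases
    case 1
    obtain x y z w where M: "proots q = {#x, y, z, w#}"
      "0 \<le> x" "0 \<le> y" "0 \<le> z" "x \<le> y" "y \<le> z"
      by (rule mset_three_sorted[OF 1 size4])
    show ?thesis
      using nonneg_case[OF M(2,5,6) coeffs[OF M(1)] g] .
  next
    case 2
    obtain x y z w where M: "proots q = {#x, y, z, w#}"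
      "x \<le> 0" "y \<le> 0" "z \<le> 0" "x \<le> y" "y \<le> z"
      by (rule mset_three_sorted[OF 2 size4])
    \<comment> \<open>Reflecting \<open>t\<close> negates \<open>c\<close> and \<open>C\<close>
      together and makes the three roots nonnegative, while the product \<open>C * c\<close> is
      unchanged.\<close>
    have "only_real_roots ([:d, 4 * c, 6 * b, 0, 1:] \<circ>\<^sub>p [:0, - 1:])"
      using g by (rule only_real_roots_affine) simp
    then have "only_real_roots [:d, 4 * (- c), 6 * b, 0, 1:]"
      by (simp add: pcompose_pCons)
    moreover have "6 * B = A * ((- z)\<^sup>2 + (- y)\<^sup>2 + (- x)\<^sup>2 + (- z) * (- y) + (- y) * (- x) + (- x) * (- z))"
      unfolding coeffs(1)[OF M(1)] by (simp add: algebra_simps)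
    moreover have "8 * (- C) = A * ((- z + - y) * (- y + - x) * (- x + - z))"
      unfolding mult_minus_right coeffs(2)[OF M(1)] by (simp add: algebra_simps)
    moreover have "3 * D = A * (- z * - y * - x * (- z + - y + - x))"
      unfolding coeffs(3)[OF M(1)] by (simp add: algebra_simps)
    moreover have "0 \<le> - z" "- z \<le> - y" "- y \<le> - x"
      using M by simp_all
    ultimately have "only_real_roots [:D * d, 4 * (- C) * (- c), 6 * B * b, 0, A:]"
      using nonneg_case[of "- z" "- y" "- x" B "- C" D d "- c" b] by satx
    then show ?thesis by simp
  qed
qed

section \<open>Evaluation, symmetry and homogeneity of polynomials in several variables\<close>

lemma msubst_superset:
  assumes "finite K" "Poly_Mapping.keys p \<subseteq> K" "c 0 = 0"
  shows "msubst c f p =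
     (\<Sum>m\<in>K. c (Poly_Mapping.lookup p m) * (\<Prod>i\<in>UNIV. f i ^ Poly_Mapping.lookup m i))"
  unfolding msubst_def using assms
  by (intro sum.mono_neutral_left) (auto simp: in_keys_iff)

text \<open>Under these conditions \<open>msubst c f\<close> is a ring homomorphism. Evaluation and
  permutation of variables are the two instances used.\<close>

locale coefficient_hom =
  fixes c :: "real \<Rightarrow> 'b::comm_semiring_1"
  assumes zero: "c 0 = 0" and one: "c 1 = 1"
    and add: "c (a + b) = c a + c b" and mult: "c (a * b) = c a * c b"
begin

lemma msubst_single:
  "msubst c f (Poly_Mapping.single m a) = c a * (\<Prod>i\<in>UNIV. f i ^ Poly_Mapping.lookup m i)"
  by (subst msubst_superset[of "{m}"]) (auto simp: zero)

lemma msubst_add: "msubst c f (p + q) = msubst c f p + msubst c f q"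
proof -
  let ?K = "Poly_Mapping.keys p \<union> Poly_Mapping.keys q"
  have "Poly_Mapping.keys (p + q) \<subseteq> ?K"
    by (rule keys_add)
  then show ?thesis
    by (subst (1 2 3) msubst_superset[of ?K])
       (auto simp: zero lookup_add add distrib_right sum.distrib)
qed

lemma msubst_zero: "msubst c f 0 = 0"
  by (simp add: msubst_def)

lemma msubst_sum: "msubst c f (sum g S) = (\<Sum>x\<in>S. msubst c f (g x))"
  by (induction S rule: infinite_finite_induct) (simp_all add: msubst_zero msubst_add)

lemma msubst_mult: "msubst c f (p * q) = msubst c f p * msubst c f q"
proof -
  have single: "msubst c f (Poly_Mapping.single m a * Poly_Mapping.single m' a') =
      msubst c f (Poly_Mapping.single m a) * msubst c f (Poly_Mapping.single m' a')" for m m' a a'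
    by (simp add: mult_single msubst_single mult lookup_add power_add prod.distrib mult_ac)
  have expand: "p = (\<Sum>m\<in>Poly_Mapping.keys p. Poly_Mapping.single m (Poly_Mapping.lookup p m))"
    for p :: "'n::finite real_mpoly"
    by (rule poly_mapping_eqI)
       (auto simp: lookup_sum lookup_single when_def in_keys_iff)
  \<comment> \<open>The coefficient functions are kept arbitrary so that \<open>expand\<close> can
    be folded back; unfolding it would loop.\<close>
  have "msubst c f ((\<Sum>m\<in>K. Poly_Mapping.single m (g m)) * (\<Sum>m\<in>L. Poly_Mapping.single m (h m))) =
      msubst c f (\<Sum>m\<in>K. Poly_Mapping.single m (g m)) * msubst c f (\<Sum>m\<in>L. Poly_Mapping.single m (h m))"
    for K L g h
    by (simp only: sum_product msubst_sum single)
  from this[of "Poly_Mapping.lookup p" "Poly_Mapping.keys p" "Poly_Mapping.lookup q" "Poly_Mapping.keys q"]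
  show ?thesis
    unfolding expand[symmetric] .
qed

lemma msubst_one: "msubst c f 1 = 1"
  using msubst_single[of f 0 1] by (simp add: one)

lemma msubst_power: "msubst c f (p ^ k) = msubst c f p ^ k"
  by (induction k) (simp_all add: msubst_one msubst_mult)

lemma msubst_prod: "msubst c f (prod g S) = (\<Prod>x\<in>S. msubst c f (g x))"
  by (induction S rule: infinite_finite_induct) (simp_all add: msubst_one msubst_mult)

lemma msubst_mconst: "msubst c f (mconst a) = c a"
  by (simp add: mconst_def msubst_single)

lemma msubst_mvar: "msubst c f (mvar i) = f i"
proof -
  have "(\<Prod>j\<in>UNIV. f j ^ Poly_Mapping.lookup (Poly_Mapping.single i 1) j) =
      (\<Prod>j\<in>UNIV. if j = i then f j else 1)"
    by (intro prod.cong) (auto simp: lookup_single when_def)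
  then show ?thesis
    by (simp add: mvar_def msubst_single one)
qed

lemma msubst_esym: "msubst c f (esym k) = (\<Sum>S | card S = k. \<Prod>i\<in>S. f i)"
  by (simp add: esym_def msubst_sum msubst_prod msubst_mvar)

lemmas msubst_simps =
  msubst_add msubst_mult msubst_power msubst_mconst msubst_mvar

end

interpretation eval_hom: coefficient_hom "\<lambda>a. a"
  by standard auto

interpretation mconst_hom: coefficient_hom "mconst :: real \<Rightarrow> 'n::finite real_mpoly"
  by standard (simp_all add: mconst_def single_add mult_single)

section \<open>Homogeneity\<close>

lemma homogeneous_mconst: "homogeneous 0 (mconst a)"
  by (simp add: homogeneous_def mconst_def)

lemma homogeneous_mvar: "homogeneous 1 (mvar i)"
  by (simp add: homogeneous_def mvar_def lookup_single when_def)

lemma homogeneous_add: "homogeneous d p \<Longrightarrow> homogeneous d q \<Longrightarrow> homogeneous d (p + q)"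
  unfolding homogeneous_def using keys_add[of p q] by blast

lemma homogeneous_mult:
  assumes "homogeneous d p" "homogeneous e q"
  shows "homogeneous (d + e) (p * q)"
  unfolding homogeneous_def
proof
  fix m assume "m \<in> Poly_Mapping.keys (p * q)"
  then obtain a b where "m = a + b" "a \<in> Poly_Mapping.keys p" "b \<in> Poly_Mapping.keys q"
    using keys_mult[of p q] by blast
  then show "(\<Sum>i\<in>UNIV. Poly_Mapping.lookup m i) = d + e"
    using assms by (simp add: homogeneous_def lookup_add sum.distrib)
qed

lemma homogeneous_one: "homogeneous 0 1"
  using homogeneous_mconst[of 1] by (simp add: mconst_def)

lemma homogeneous_power: "homogeneous d p \<Longrightarrow> homogeneous (k * d) (p ^ k)"
  by (induction k) (auto intro: homogeneous_mult homogeneous_one)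

lemma homogeneous_sum: "(\<And>x. x \<in> S \<Longrightarrow> homogeneous d (g x)) \<Longrightarrow> homogeneous d (sum g S)"
proof (induction S rule: infinite_finite_induct)
  case (insert x S)
  then show ?case by (auto intro: homogeneous_add)
qed (simp_all add: homogeneous_def)

lemma homogeneous_prod_mvar: "homogeneous (card S) (\<Prod>i\<in>S. mvar i)" for S :: "'n::finite set"
  using finite[of S]
proof (induction S rule: finite_induct)
  case (insert x S)
  then show ?case
    using homogeneous_mult[OF homogeneous_mvar[of x]] by simp
qed (simp add: homogeneous_one)

lemma homogeneous_esym: "homogeneous k (esym k)"
  unfolding esym_def
  by (intro homogeneous_sum) (use homogeneous_prod_mvar in auto)

text \<open>Removing \<open>T\<close> leaves an arbitrary subset of the complement of size
  \<open>k - card T\<close>.\<close>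

lemma card_supersets:
  fixes T :: "'n::finite set"
  assumes "card T \<le> k"
  shows "card {S. T \<subseteq> S \<and> card S = k} = (CARD('n) - card T) choose (k - card T)"
proof -
  have "bij_betw (\<lambda>S. S - T) {S. T \<subseteq> S \<and> card S = k} {R. R \<subseteq> - T \<and> card R = k - card T}"
  proof (rule bij_betw_byWitness[where f' = "\<lambda>R. R \<union> T"])
    show "(\<lambda>S. S - T) ` {S. T \<subseteq> S \<and> card S = k} \<subseteq> {R. R \<subseteq> - T \<and> card R = k - card T}"
      by (auto simp: card_Diff_subset)
    have "card (R \<union> T) = k" if "R \<subseteq> - T" "card R = k - card T" for R
    proof -
      have "card (R \<union> T) = card R + card T"
        using that by (intro card_Un_disjoint) auto
      then show ?thesis
        using that assms by simp
    qed
    then show "(\<lambda>R. R \<union> T) ` {R. R \<subseteq> - T \<and> card R = k - card T} \<subseteq> {S. T \<subseteq> S \<and> card S = k}"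
      by blast
  qed auto
  then have "card {S. T \<subseteq> S \<and> card S = k} = card {R. R \<subseteq> - T \<and> card R = k - card T}"
    by (rule bij_betw_same_card)
  also have "\<dots> = card (- T) choose (k - card T)"
    by (rule n_subsets) simp
  finally show ?thesis
    by (simp add: card_Diff_subset Compl_eq_Diff_UNIV)
qed

section \<open>Values of elementary symmetric polynomials\<close>

definition esymv :: "nat \<Rightarrow> real^'n \<Rightarrow> real" where
  "esymv k x = (\<Sum>S | card S = k. \<Prod>i\<in>S. x $ i)"

lemma meval_esym: "meval (esym k) x = esymv k x"
  by (simp add: meval_def esymv_def eval_hom.msubst_esym)

text \<open>Expanding each product selects the set \<open>T\<close> of factors contributing a
  coordinate of \<open>x\<close>. Exchanging the sums, each \<open>T\<close> is counted once per
  superset of size \<open>k\<close>; the sets \<open>T\<close> are then grouped by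
  cardinality.\<close>

lemma esymv_shift:
  fixes x :: "real^'n"
  shows "esymv k (x + t *\<^sub>R vec 1) =
    (\<Sum>j\<le>k. of_nat ((CARD('n) - j) choose (k - j)) * esymv j x * t ^ (k - j))"
proof -
  have "esymv k (x + t *\<^sub>R vec 1) =
      (\<Sum>S | card S = k. \<Sum>T | T \<subseteq> S. (\<Prod>i\<in>T. x $ i) * t ^ (k - card T))"
    unfolding esymv_def
  proof (intro sum.cong refl)
    fix S :: "'n set" assume "S \<in> {S. card S = k}"
    then show "(\<Prod>i\<in>S. (x + t *\<^sub>R vec 1) $ i) = (\<Sum>T | T \<subseteq> S. (\<Prod>i\<in>T. x $ i) * t ^ (k - card T))"
      by (simp add: prod_add Pow_def card_Diff_subset)
  qed
  also have "\<dots> = (\<Sum>T\<in>{T. card T \<le> k}. \<Sum>S | T \<subseteq> S \<and> card S = k. (\<Prod>i\<in>T. x $ i) * t ^ (k - card T))"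
  proof -
    have "(\<Sum>S | card S = k. \<Sum>T | T \<subseteq> S. (\<Prod>i\<in>T. x $ i) * t ^ (k - card T)) =
        (\<Sum>S | card S = k. \<Sum>T\<in>{T\<in>{T. card T \<le> k}. T \<subseteq> S}. (\<Prod>i\<in>T. x $ i) * t ^ (k - card T))"
      by (intro sum.cong refl) (auto intro: card_mono)
    also have "\<dots> = (\<Sum>T\<in>{T. card T \<le> k}. \<Sum>S\<in>{S\<in>{S. card S = k}. T \<subseteq> S}.
        (\<Prod>i\<in>T. x $ i) * t ^ (k - card T))"
      by (rule sum.swap_restrict) auto
    also have "\<dots> = (\<Sum>T\<in>{T. card T \<le> k}. \<Sum>S | T \<subseteq> S \<and> card S = k.
        (\<Prod>i\<in>T. x $ i) * t ^ (k - card T))"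
      by (intro sum.cong refl) auto
    finally show ?thesis .
  qed
  also have "\<dots> = (\<Sum>T\<in>{T. card T \<le> k}. of_nat ((CARD('n) - card T) choose (k - card T)) *
      (\<Prod>i\<in>T. x $ i) * t ^ (k - card T))"
    by (intro sum.cong) (auto simp: card_supersets)
  also have "\<dots> = (\<Sum>j\<le>k. \<Sum>T\<in>{T. T \<in> {T. card T \<le> k} \<and> card T = j}.
      of_nat ((CARD('n) - card T) choose (k - card T)) * (\<Prod>i\<in>T. x $ i) * t ^ (k - card T))"
    by (rule sum.group[symmetric]) auto
  also have "\<dots> = (\<Sum>j\<le>k. of_nat ((CARD('n) - j) choose (k - j)) * esymv j x * t ^ (k - j))"
    unfolding esymv_def sum_distrib_left sum_distrib_right
    by (intro sum.cong) auto
  finally show ?thesis .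
qed

lemma esymv_0: "esymv 0 x = 1"
proof -
  have "{S :: 'a set. card S = 0} = {{}}" by auto
  then show ?thesis by (simp add: esymv_def)
qed

lemma esymv_1: "esymv 1 x = (\<Sum>i\<in>UNIV. x $ i)"
proof -
  have "{S :: 'a set. card S = 1} = (\<lambda>i. {i}) ` UNIV"
    by (auto simp: card_1_singleton_iff)
  then show ?thesis by (simp add: esymv_def sum.reindex)
qed

lemma coeff_prod_linear_esymv:
  fixes x :: "real^'n"
  assumes "k \<le> CARD('n)"
  shows "coeff (\<Prod>i\<in>UNIV. [:x $ i, 1:]) (CARD('n) - k) = esymv k x"
proof -
  have linear: "[:x $ i, 1:] = [:x $ i:] + monom 1 1" for i
    by (simp add: monom_Suc monom_0)
  have const: "(\<Prod>i\<in>T. [:x $ i:]) = [:\<Prod>i\<in>T. x $ i:]" for T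
    by (induction T rule: infinite_finite_induct) auto
  have "(\<Prod>i\<in>UNIV. [:x $ i, 1:]) = (\<Sum>T\<in>UNIV. monom (\<Prod>i\<in>T. x $ i) (CARD('n) - card T))"
    unfolding linear
    by (simp add: prod_add const monom_power card_Diff_subset smult_monom)
  then have "coeff (\<Prod>i\<in>UNIV. [:x $ i, 1:]) (CARD('n) - k) =
      (\<Sum>T\<in>UNIV. if card T = k then \<Prod>i\<in>T. x $ i else 0)"
    using assms by (auto simp: coeff_sum intro!: sum.cong)
       (metis card_mono diff_diff_cancel finite subset_UNIV)
  then show ?thesis
    by (simp add: esymv_def sum.If_cases)
qed

section \<open>Hook-shaped quartics\<close>

text \<open>The indices of the factors form the hook partitions of 4; only (2,2), that is
  \<open>e2^2\<close>, is missing.\<close>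

definition hook :: "real \<Rightarrow> real \<Rightarrow> real \<Rightarrow> real \<Rightarrow> 'n::finite real_mpoly" where
  "hook a1 a2 a3 a4 = mconst a1 * esym 1 ^ 4 + mconst a2 * esym 1 ^ 2 * esym 2
     + mconst a3 * esym 1 * esym 3 + mconst a4 * esym 4"

lemma msubst_permuted_esym:
  fixes \<pi> :: "'n::finite \<Rightarrow> 'n"
  assumes "\<pi> permutes UNIV"
  shows "msubst mconst (\<lambda>i. mvar (\<pi> i)) (esym k) = esym k"
proof -
  have "bij \<pi>"
    using assms by (simp add: permutes_bij)
  then have inj: "inj \<pi>"
    by (rule bij_is_inj)
  have "bij_betw ((`) \<pi>) {S. card S = k} {S. card S = k}"
  proof (rule bij_betw_imageI)
    show inj_image: "inj_on ((`) \<pi>) {S. card S = k}"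
      by (rule inj_onI) (simp add: inj_image_eq_iff[OF inj])
    show "(`) \<pi> ` {S. card S = k} = {S. card S = k}"
      using inj_image
      by (rule endo_inj_surj[rotated 2]) (auto simp: card_image inj_on_subset[OF inj])
  qed
  have "msubst mconst (\<lambda>i. mvar (\<pi> i)) (esym k) = (\<Sum>S | card S = k. \<Prod>i\<in>\<pi> ` S. mvar i)"
    unfolding mconst_hom.msubst_esym
    by (intro sum.cong refl, subst prod.reindex) (auto intro: inj_on_subset[OF inj])
  also have "\<dots> = esym k"
    unfolding esym_def by (rule sum.reindex_bij_betw) fact
  finally show ?thesis .
qed

lemma symmetric_hook: "symmetric_mpoly (hook a1 a2 a3 a4)"
  unfolding symmetric_mpoly_def hook_def
  by (simp add: mconst_hom.msubst_simps msubst_permuted_esym)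

lemma homogeneous_hook: "homogeneous 4 (hook a1 a2 a3 a4)"
proof -
  have "homogeneous (0 + 4 * 1) (mconst a1 * esym 1 ^ 4)"
    "homogeneous (0 + 2 * 1 + 2) (mconst a2 * esym 1 ^ 2 * esym 2)"
    "homogeneous (0 + 1 + 3) (mconst a3 * esym 1 * esym 3)"
    "homogeneous (0 + 4) (mconst a4 * esym 4)"
    by (intro homogeneous_mult homogeneous_power homogeneous_mconst homogeneous_esym)+
  then show ?thesis
    unfolding hook_def by (intro homogeneous_add) (simp_all add: numeral_eq_Suc)
qed

lemma meval_hook:
  "meval (hook a1 a2 a3 a4) x = a1 * esymv 1 x ^ 4 + a2 * esymv 1 x ^ 2 * esymv 2 x
     + a3 * esymv 1 x * esymv 3 x + a4 * esymv 4 x"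
  unfolding hook_def by (simp add: meval_def eval_hom.msubst_simps meval_esym[unfolded meval_def])

text \<open>Moving the base point along \<open>v\<close> only translates the parameter, which allows
  every point to be recentred to \<open>e1 = 0\<close>.\<close>

lemma mline_shift:
  "mline p (x + c *\<^sub>R v) v = mline p x v \<circ>\<^sub>p [:c, 1:]"
  by (intro poly_eq_poly_eq_iff[THEN iffD1] ext)
     (simp add: poly_mline poly_pcompose algebra_simps)

text \<open>On the hyperplane \<open>e1 = 0\<close>, \<open>e1\<close> becomes \<open>n t\<close>
  along the line and no \<open>e_k\<close> contributes its next-to-leading power. Owing to the hook
  shape, each lower coefficient is a constant multiple of a single \<open>e_k(y)\<close>.\<close>

lemma mline_hook:
  fixes y :: "real^'n"
  assumes y: "esymv 1 y = 0"
  defines "n \<equiv> CARD('n)"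
  shows "mline (hook a1 a2 a3 a4) y (vec 1) =
    [: a4 * esymv 4 y, (a3 * n + a4 * (n - 3 choose 1)) * esymv 3 y,
       (a2 * n\<^sup>2 + a3 * n * (n - 2 choose 1) + a4 * (n - 2 choose 2)) * esymv 2 y, 0,
       meval (hook a1 a2 a3 a4) (vec 1 :: real^'n) :]"
proof (intro poly_eq_poly_eq_iff[THEN iffD1] ext)
  fix t :: real
  have sets: "{..1::nat} = {0, 1}" "{..2::nat} = {0, 1, 2}" "{..3::nat} = {0, 1, 2, 3}"
    "{..4::nat} = {0, 1, 2, 3, 4}"
    by auto
  have e1: "esymv 1 (z + t *\<^sub>R vec 1) = real n * t" if "esymv 1 z = 0" for z :: "real^'n" and t :: real
    using that unfolding esymv_shift sets n_def by (simp add: esymv_0)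
  have e2: "esymv 2 (z + t *\<^sub>R vec 1) = real (n choose 2) * t\<^sup>2 + esymv 2 z"
    if "esymv 1 z = 0" for z :: "real^'n" and t :: real
    using that unfolding esymv_shift sets n_def by (simp add: esymv_0)
  have e3: "esymv 3 (z + t *\<^sub>R vec 1) = real (n choose 3) * t ^ 3 + (n - 2 choose 1) * esymv 2 z * t + esymv 3 z"
    if "esymv 1 z = 0" for z :: "real^'n" and t :: real
    using that unfolding esymv_shift sets n_def by (simp add: esymv_0)
  have e4: "esymv 4 (z + t *\<^sub>R vec 1) = real (n choose 4) * t ^ 4 + (n - 2 choose 2) * esymv 2 z * t\<^sup>2
      + (n - 3 choose 1) * esymv 3 z * t + esymv 4 z"
    if "esymv 1 z = 0" for z :: "real^'n" and t :: real
    using that unfolding esymv_shift sets n_def by (simp add: esymv_0)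
  have zero: "esymv k (0 :: real^'n) = 0" if "k > 0" for k
    unfolding esymv_def using that by (intro sum.neutral) (auto simp: card_gt_0_iff)
  \<comment> \<open>The leading coefficient is computed by the same shift formulas, started at the
    origin with \<open>t = 1\<close>.\<close>
  have one: "esymv k (vec 1 :: real^'n) = esymv k ((0 :: real^'n) + 1 *\<^sub>R vec 1)" for k
    by simp
  show "poly (mline (hook a1 a2 a3 a4) y (vec 1)) t = poly
    [: a4 * esymv 4 y, (a3 * n + a4 * (n - 3 choose 1)) * esymv 3 y,
       (a2 * n\<^sup>2 + a3 * n * (n - 2 choose 1) + a4 * (n - 2 choose 2)) * esymv 2 y, 0,
       meval (hook a1 a2 a3 a4) (vec 1 :: real^'n) :] t"
    unfolding poly_mline meval_hook e1[OF y] e2[OF y] e3[OF y] e4[OF y]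
      one e1[OF zero[OF zero_less_one]] e2[OF zero[OF zero_less_one]]
      e3[OF zero[OF zero_less_one]] e4[OF zero[OF zero_less_one]]
    by (simp add: zero algebra_simps power2_eq_square power3_eq_cube power4_eq_xxxx)
qed

text \<open>Only \<open>e_0\<close> and \<open>e_1\<close> are nonzero at a coordinate vector, so
  two terms of the shift formula survive; they combine by
  \<open>n * (n - 1 choose (k - 1)) = k * (n choose k)\<close>.\<close>

lemma esymv_axis_shift:
  fixes i :: "'n::finite"
  assumes k: "k > 0"
  shows "esymv k (axis i 1 + (- 1 / CARD('n)) *\<^sub>R vec 1) =
    (CARD('n) choose k) * (1 - real k) * (- 1 / CARD('n)) ^ k"
proof -
  define n where "n = CARD('n)"
  define t where "t = - 1 / real n"
  have n: "n > 0" by (simp add: n_def)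
  have axis: "esymv j (axis i 1 :: real^'n) = 0" if "j \<ge> 2" for j
    unfolding esymv_def
  proof (intro sum.neutral ballI)
    fix S :: "'n set" assume "S \<in> {S. card S = j}"
    then have "\<not> S \<subseteq> {i}"
      using that card_mono[of "{i}" S] by auto
    then show "(\<Prod>l\<in>S. axis i 1 $ l) = (0 :: real)"
      by (intro prod_zero) (auto simp: axis_def)
  qed
  have "esymv 1 (axis i 1 :: real^'n) = 1"
    unfolding esymv_1 by (simp add: axis_def)
  have "esymv k (axis i 1 + t *\<^sub>R vec 1) =
      (\<Sum>j\<in>{0, 1}. ((n - j) choose (k - j)) * esymv j (axis i 1 :: real^'n) * t ^ (k - j))"
    unfolding esymv_shift n_def[symmetric] using k
    by (intro sum.mono_neutral_right) (auto simp: axis)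
  also have "\<dots> = (n choose k) * t ^ k + (n - 1 choose (k - 1)) * t ^ (k - 1)"
    using \<open>esymv 1 _ = 1\<close> by (simp add: esymv_0)
  also have "t ^ (k - 1) = - real n * t ^ k"
    using k n by (cases k) (simp_all add: t_def)
  also have "(n choose k) * t ^ k + (n - 1 choose (k - 1)) * (- real n * t ^ k) =
      (n choose k) * t ^ k - real (n * (n - 1 choose (k - 1))) * t ^ k"
    by simp
  also have "n * (n - 1 choose (k - 1)) = k * (n choose k)"
    using times_binomial_minus1_eq[OF k] by simp
  finally show ?thesis
    by (simp add: t_def n_def algebra_simps)
qed

section \<open>The real-rooted quartic attached to a point, and a test vector\<close>

lemma only_real_roots_prod:
  "(\<And>i. i \<in> S \<Longrightarrow> only_real_roots (f i)) \<Longrightarrow> only_real_roots (prod f S)"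
  by (induction S rule: infinite_finite_induct)
     (auto simp: only_real_roots_mult_iff, auto simp: only_real_roots_def)

text \<open>This is the \<open>(n - 4)\<close>-th derivative of the real-rooted product of the
  factors \<open>t + y_i\<close>, divided by its leading coefficient \<open>n! / 24\<close>.\<close>

lemma only_real_roots_esymv_quartic:
  fixes y :: "real^'n"
  assumes n: "CARD('n) \<ge> 4"
  shows "only_real_roots [: esymv 4 y / (CARD('n) choose 4), 4 * esymv 3 y / (CARD('n) choose 3),
           6 * esymv 2 y / (CARD('n) choose 2), 4 * esymv 1 y / CARD('n), 1 :]"
    (is "only_real_roots ?g")
proof -
  define N where "N = CARD('n)"
  define m where "m = N - 4"
  have N: "N = m + 4" using n by (simp add: m_def N_def)
  define F where "F = (\<Prod>i\<in>UNIV. [:y $ i, 1:])"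
  have "degree F = (\<Sum>i\<in>(UNIV::'n set). 1)"
    unfolding F_def by (subst degree_prod_eq_sum_degree) auto
  then have degF: "degree F = m + 4"
    by (simp add: N[unfolded N_def])
  have "only_real_roots F"
    unfolding F_def by (intro only_real_roots_prod only_real_roots_linear)
  then have "only_real_roots ((pderiv ^^ m) F)"
    using degF by (rule only_real_roots_higher_pderiv)
  also have "(pderiv ^^ m) F = smult (fact N / 24) ?g"
  proof (rule poly_eqI)
    fix j
    show "coeff ((pderiv ^^ m) F) j = coeff (smult (fact N / 24) ?g) j"
    proof (cases "j \<le> 4")
      case False
      then show ?thesis
        using degF by (simp add: coeff_higher_pderiv coeff_eq_0)
    next
      case True
      have g: "coeff ?g j = (4 choose j) * esymv (4 - j) y / (N choose (4 - j))"
      proof -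
        from True consider "j = 0" | "j = 1" | "j = 2" | "j = 3" | "j = 4" by linarith
        then show ?thesis
          by cases (simp_all add: N_def esymv_0 eval_nat_numeral)
      qed
      have "fact (j + m) = (fact j :: real) * pochhammer (of_nat (Suc j)) m"
        by (simp add: pochhammer_fact pochhammer_product' add.commute)
      then have poch: "pochhammer (of_nat (Suc j)) m = (fact (j + m) / fact j :: real)"
        by simp
      have "coeff ((pderiv ^^ m) F) j = fact (j + m) / fact j * coeff F (N - (4 - j))"
      proof -
        have "N - (4 - j) = j + m"
          using True by (simp add: N)
        then show ?thesis
          by (simp only: coeff_higher_pderiv poch)
      qed
      also have "coeff F (N - (4 - j)) = esymv (4 - j) y"
        unfolding F_def N_def by (rule coeff_prod_linear_esymv) (use n in simp)
      also have "fact (j + m) / fact j = fact N / 24 * ((4 choose j) / (N choose (4 - j)) :: real)"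
      proof -
        have binom_N: "real (N choose (4 - j)) = fact N / (fact (4 - j) * fact (j + m))"
          using True by (subst binomial_fact) (simp_all add: N add.commute[of m j])
        have binom_4: "real (4 choose j) = 24 / (fact j * fact (4 - j))"
          using True by (subst binomial_fact) (simp_all add: fact_numeral)
        show ?thesis
          unfolding binom_N binom_4 by simp
      qed
      finally show ?thesis
        unfolding coeff_smult g by simp
    qed
  qed
  finally show ?thesis
    by (subst (asm) only_real_roots_smult_iff) simp_all
qed

text \<open>For two coordinates 1, two coordinates -1 and zeros elsewhere, the product of the
  \<open>t + y_i\<close> is \<open>t^(n - 4) (t^2 - 1)^2\<close>, whose coefficients are the
  required values.\<close>

lemma exists_balanced_vector:
  assumes n: "CARD('n::finite) \<ge> 4"
  obtains y :: "real^'n" where "esymv 1 y = 0" "esymv 2 y = - 2" "esymv 3 y = 0" "esymv 4 y = 1"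
proof -
  obtain T :: "'n set" where "card T = 4"
    using obtain_subset_with_card_n[OF n] by blast
  then obtain a b c d where T: "T = {a, b, c, d}" "distinct [a, b, c, d]"
    by (auto simp: card_Suc_eq eval_nat_numeral)
  define y :: "real^'n" where
    "y = (\<chi> i. if i = a \<or> i = b then 1 else if i = c \<or> i = d then - 1 else 0)"
  have "(\<Prod>i\<in>UNIV. [:y $ i, 1:]) = (\<Prod>i\<in>T. [:y $ i, 1:]) * (\<Prod>i\<in>UNIV - T. [:y $ i, 1:])"
    by (subst prod.subset_diff[of T]) (auto simp: mult.commute)
  also have "(\<Prod>i\<in>T. [:y $ i, 1:]) = [:1, 0, - 2, 0, 1:]"
    using T(2) by (auto simp: T y_def)
  also have "(\<Prod>i\<in>UNIV - T. [:y $ i, 1:]) = (\<Prod>i\<in>UNIV - T. monom 1 1)"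
    by (intro prod.cong) (auto simp: T y_def monom_Suc monom_0)
  also have "\<dots> = monom 1 (CARD('n) - 4)"
    using \<open>card T = 4\<close> by (simp add: monom_power card_Diff_subset)
  finally have prod: "(\<Prod>i\<in>UNIV. [:y $ i, 1:]) = monom 1 (CARD('n) - 4) * [:1, 0, - 2, 0, 1:]"
    by (simp only: mult.commute)
  have "esymv k y = coeff [:1, 0, - 2, 0, 1:] (4 - k)" if "k \<le> 4" for k
  proof -
    have "esymv k y = coeff (monom 1 (CARD('n) - 4) * [:1, 0, - 2, 0, 1:]) (CARD('n) - k)"
      unfolding prod[symmetric] using n that by (intro coeff_prod_linear_esymv[symmetric]) simp
    also have "CARD('n) - k = (CARD('n) - 4) + (4 - k)"
      using n that by simp
    finally show ?thesis
      by (simp only: coeff_monom_mult add_diff_cancel_left' not_add_less1 if_False)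
  qed
  from this[of 1] this[of 2] this[of 3] this[of 4] show thesis
    by (intro that[of y]) (simp_all add: eval_nat_numeral)
qed

text \<open>The vanishing linear coefficient makes two roots opposite, and then the other two as
  well, because all four sum to zero. So \<open>c / A\<close> is a square.\<close>

lemma even_quartic_constant_coeff:
  assumes f: "only_real_roots [:c, 0, a, 0, A:]" and A: "A \<noteq> 0"
  shows "c * A \<ge> 0"
proof -
  define f where "f = [:c, 0, a, 0, A:]"
  have f: "f \<noteq> 0" "degree f = 4" "lead_coeff f = A" "only_real_roots f"
    using assms by (simp_all add: f_def)
  note dec = only_real_roots_decompose[OF f(4,1)]
  obtain x y z w where M: "proots f = {#x, y, z, w#}"
    using dec(2) f(2) size_4_mset by metis
  have eq: "[:c, 0, a, 0, A:] = smult A (\<Prod>r\<in>#{#x, y, z, w#}. [:- r, 1:])"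
    using dec(1) unfolding M f(3) unfolding f_def .
  have c: "c = - A * (x * y * z * (x + y + z))" and "0 = A * ((x + y) * (y + z) * (z + x))"
    by (rule depressed_quartic_coeffs[OF eq A])+
  then consider "y = - x" | "z = - y" | "x = - z"
    using A by (auto simp: add_eq_0_iff)
  then have "c = A * (x * z)\<^sup>2 \<or> c = A * (x * y)\<^sup>2 \<or> c = A * (y * z)\<^sup>2"
    unfolding c by cases (simp_all add: power2_eq_square)
  then have "c * A = (A * (x * z))\<^sup>2 \<or> c * A = (A * (x * y))\<^sup>2 \<or> c * A = (A * (y * z))\<^sup>2"
    by (auto simp: power2_eq_square)
  then show ?thesis by auto
qed

theorem corollary1p11:
  fixes a1 a2 a3 a4 :: real
    and p :: "'n::finite real_mpoly"
    and u :: "real^'n"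
    and k :: 'n
    and q :: "real poly"
  assumes "CARD('n) \<ge> 4"
    and "p = mconst a1 * esym 1 ^ 4 + mconst a2 * esym 1 ^ 2 * esym 2
             + mconst a3 * esym 1 * esym 3 + mconst a4 * esym 4"
    and "meval p (vec 1) \<noteq> 0"
    and "u = axis k 1"
    and "q = mline p u (vec 1)"
  shows "symmetric_hyperbolic p \<longleftrightarrow>
           only_real_roots (q \<circ>\<^sub>p [:- 1 / real CARD('n), 1:]) \<and>
           has_roots_of_same_sign 3 (q \<circ>\<^sub>p [:- 1 / real CARD('n), 1:])"
proof -
  define n where "n = CARD('n)"
  define A where "A = meval p (vec 1)"
  define B where "B = a2 * n\<^sup>2 + a3 * n * (n - 2 choose 1) + a4 * (n - 2 choose 2)"
  define C where "C = a3 * n + a4 * (n - 3 choose 1)"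
  define D where "D = a4"
  define N2 N3 N4 where "N2 = real (n choose 2)" and "N3 = real (n choose 3)"
    and "N4 = real (n choose 4)"
  have n: "n \<ge> 4" using assms(1) by (simp add: n_def)
  have N: "N2 > 0" "N3 > 0" "N4 > 0"
    using n by (simp_all add: N2_def N3_def N4_def)
  have p: "p = hook a1 a2 a3 a4"
    using assms(2) by (simp add: hook_def)
  have A: "A \<noteq> 0"
    using assms(3) by (simp add: A_def)
  have line: "mline p y (vec 1) = [:D * esymv 4 y, C * esymv 3 y, B * esymv 2 y, 0, A:]"
    if "esymv 1 y = 0" for y
    unfolding A_def B_def C_def D_def n_def p using mline_hook[OF that] .
  \<comment> \<open>The translate of \<open>u\<close> with coordinate sum zero; its line polynomial
    is the shifted \<open>q\<close>.\<close>
  define y0 where "y0 = u + (- 1 / n) *\<^sub>R vec 1"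
  have y0: "esymv k y0 = (n choose k) * (1 - real k) * (- 1 / n) ^ k" if "k > 0" for k
    unfolding y0_def n_def assms(4) using esymv_axis_shift[OF that] .
  have f: "q \<circ>\<^sub>p [:- 1 / real CARD('n), 1:] = mline p y0 (vec 1)"
    unfolding y0_def assms(5) mline_shift n_def ..
  have y0_1: "esymv 1 y0 = 0"
    by (simp add: y0)
  have y0_4: "esymv 4 y0 = - 3 * N4 / n ^ 4"
    by (simp add: y0 N4_def power_one_over)
  have hyperbolic: "symmetric_hyperbolic p \<longleftrightarrow> (\<forall>x. only_real_roots (mline p x (vec 1)))"
    using symmetric_hook homogeneous_hook assms(3)
    unfolding symmetric_hyperbolic_def hyperbolic_wrt_def p by blast
  show ?thesis
    unfolding f hyperbolic
  proof
    assume all: "\<forall>x. only_real_roots (mline p x (vec 1))"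
    \<comment> \<open>At the balanced vector the linear term disappears, which yields
      \<open>D * A \<ge> 0\<close>. Since \<open>e4(y0)\<close> is negative, the product of the
      roots at \<open>y0\<close> is nonpositive.\<close>
    obtain y :: "real^'n" where "esymv 1 y = 0" "esymv 2 y = - 2" "esymv 3 y = 0" "esymv 4 y = 1"
      using exists_balanced_vector assms(1) by blast
    then have "only_real_roots [:D, 0, B * - 2, 0, A:]"
      using all line[of y] by (metis mult_1_right mult_zero_right)
    then have "D * A \<ge> 0"
      using A by (rule even_quartic_constant_coeff)
    with N have "D * A * (3 * N4 / n ^ 4) \<ge> 0"
      by (intro mult_nonneg_nonneg[of "D * A"]) simp_all
    then have "D * esymv 4 y0 * A \<le> 0"
      by (simp add: y0_4 mult_ac)
    moreover have "only_real_roots (mline p y0 (vec 1))"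
      using all by blast
    ultimately show "only_real_roots (mline p y0 (vec 1)) \<and> has_roots_of_same_sign 3 (mline p y0 (vec 1))"
      unfolding line[OF y0_1] using A same_sign_of_quartic by blast
  next
    assume asm: "only_real_roots (mline p y0 (vec 1)) \<and> has_roots_of_same_sign 3 (mline p y0 (vec 1))"
    \<comment> \<open>The coefficients are brought into the form required by
      \<open>quartic_composition\<close>, the binomials and powers of \<open>n\<close> being
      absorbed into the multipliers.\<close>
    have line0: "mline p y0 (vec 1) =
        [:- 3 * (D * N4 / n ^ 4), 8 * (C * N3 / (4 * n ^ 3)), - 6 * (B * N2 / (6 * n ^ 2)), 0, A:]"
      unfolding line[OF y0_1] by (simp add: y0 N2_def N3_def N4_def power_divide)
    have centered: "only_real_roots (mline p y (vec 1))" if y: "esymv 1 y = 0" for y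
    proof -
      have "only_real_roots [:esymv 4 y / N4, 4 * esymv 3 y / N3, 6 * esymv 2 y / N2, 0, 1:]"
        using only_real_roots_esymv_quartic[OF assms(1), of y] y
        by (simp add: N2_def N3_def N4_def n_def)
      \<comment> \<open>Rescaling \<open>t\<close> multiplies \<open>e_k(y)\<close> by
        \<open>n^k\<close>, which cancels the powers of \<open>n\<close> in the multipliers.\<close>
      then have "only_real_roots (smult (n ^ 4)
          ([:esymv 4 y / N4, 4 * esymv 3 y / N3, 6 * esymv 2 y / N2, 0, 1:] \<circ>\<^sub>p [:0, 1 / n:]))"
        using n by (subst only_real_roots_smult_iff) (auto intro: only_real_roots_affine)
      then have "only_real_roots [:n ^ 4 * esymv 4 y / N4, 4 * (n ^ 3 * esymv 3 y / N3),
          6 * (n ^ 2 * esymv 2 y / N2), 0, 1:]"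
        using n by (simp add: pcompose_pCons field_simps eval_nat_numeral)
      from quartic_composition[OF A asm[unfolded line0, THEN conjunct1] asm[unfolded line0, THEN conjunct2] this]
      show ?thesis
        unfolding line[OF y] using n N by simp
    qed
    show "\<forall>x. only_real_roots (mline p x (vec 1))"
    proof
      fix x :: "real^'n"
      \<comment> \<open>Subtracting the mean of the coordinates reduces an arbitrary point to the
        centred case.\<close>
      define c where "c = esymv 1 x / n"
      define y where "y = x + (- c) *\<^sub>R vec 1"
      have "esymv 1 y = 0"
        unfolding y_def c_def esymv_1 using n by (simp add: sum_subtractf n_def)
      then have "only_real_roots (mline p y (vec 1) \<circ>\<^sub>p [:c, 1:])"
        by (intro only_real_roots_affine centered) auto
      then show "only_real_roots (mline p x (vec 1))"
        unfolding mline_shift[symmetric] by (simp add: y_def)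
    qed
  qed
qed

end
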